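(* Let $\epsilon>0$, $B>0$, $d>0$, let $n\ge 1$ be an integer and $A=nd$. Let $\mathcal X$ be a finite collection of convex planar bodies, each of Euclidean diameter at most $B$. Let $\mathbf H$ be the Euler histogram count vector of $\mathcal X$ on the $n\times n$ square grid with cell side length $d$. Let $\mathbf H'$ be the DiffPriv perturbation of $\mathbf H$ with Laplace noise scale $\lambda=\frac{1}{\epsilon}\cdot 4.5\left(\lceil B/d\rceil+1\right)\lceil B/d\rceil$. Let $\mathbf H''$ be a minimiser of the $L_\infty$ constrained inference program with input $\mathbf H'$, and let $\mathbf H'''$ be obtained from $\mathbf H''$ by rounding every component to a nearest integer. Then for every $\delta\in(0,1)$, with probability at least $1-\delta$ over the Laplace noise, $$\|\mathbf H-\mathbf H'''\|_\infty\le \frac{9\left(\lceil B/d\rceil+1\right)\lceil B/d\rceil}{\epsilon}\,\log\left(\frac{\frac{4A^2}{d^2}-\frac{4A}{d}+1}{\delta}\right)+0.5 .$$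
   Context: Grid: a square of side length $A$ is partitioned into $n\times n$ closed square cells of side length $d=A/n$. $\mathcal F$ indexes the cells (faces); $\mathcal E$ indexes the edges, i.e. the closed segments that are the intersections of two side-adjacent cells (interior edges only); $\mathcal V$ indexes the vertices, i.e. the interior grid points, where four edges meet. Thus $|\mathcal F|=n^2$, $|\mathcal E|=2n(n-1)$, $|\mathcal V|=(n-1)^2$. Write $\mathcal H=\mathcal F\cup\mathcal E\cup\mathcal V$ (disjoint union), and let $P_i\subset\mathbb R^2$ be the face, edge or vertex with index $i\in\mathcal H$. Euler histogram: for a finite collection $\mathcal X$ of planar bodies, $H_i=|\{x\in\mathcal X: x\cap P_i\neq\emptyset\}|$ (counted with multiplicity), $i\in\mathcal H$. DiffPriv with scale $\lambda$: $H'_i=\max(0,\,H_i+Y_i)$, where the $Y_i$, $i\in\mathcal H$, are i.i.d. Laplace random variables with mean $0$ and scale $\lambda$ (density $\frac1{2\lambda}e^{-|y|/\lambda}$). $L_\infty$ constrained inference: given $\mathbf H'$, minimise $\|\mathbf H''-\mathbf H'\|_\infty$ over real vectors $\mathbf H''\ge \mathbf 0$ indexed by $\mathcal H$ (whose face, edge, vertex components are written $F''_j,E''_k,V''_i$) subject to: (C1) $E''_i\le F''_j$ for every edge $i\in\mathcal E$ and each of its two incident faces $j$; (C2) $V''_i\le E''_j$ for every vertex $i\in\mathcal V$ and each of its four incident edges $j$; (C3) for every vertex $i\in\mathcal V$, $\sum_{j}F''_j-\sum_{k}E''_k+V''_i\ge 0$, where $j$ ranges over the four faces incident to $i$ and $k$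 over the four edges incident to $i$ (the Euler-formula count of the $2\times2$ block around $i$ is non-negative). $\log$ is the natural logarithm. *)

theory Defs
  imports "HOL-Probability.Probability" "HOL-Library.Multiset"
begin

section \<open>The grid\<close>

text \<open>Coordinates are along the sides of the square; \<^term>\<open>c\<close> is its lower left corner and
  \<^term>\<open>d\<close> the side length of a cell. \<open>VEdge i j\<close> is the (vertical) edge shared by \<open>Face i j\<close>
  and \<open>Face (i+1) j\<close>, \<open>HEdge i j\<close> the (horizontal) edge shared by \<open>Face i j\<close> and
  \<open>Face i (j+1)\<close>, and \<open>Vertex i j\<close> is the upper right corner of \<open>Face i j\<close>. All indices start
  at 0, so only the interior edges and vertices occur.\<close>

datatype grid_index = Face nat nat | VEdge nat nat | HEdge nat nat | Vertex nat nat

definition faces :: "nat \<Rightarrow> grid_index set" where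
  "faces n = {Face i j | i j. i < n \<and> j < n}"

definition edges :: "nat \<Rightarrow> grid_index set" where
  "edges n = {VEdge i j | i j. Suc i < n \<and> j < n} \<union> {HEdge i j | i j. i < n \<and> Suc j < n}"

definition vertices :: "nat \<Rightarrow> grid_index set" where
  "vertices n = {Vertex i j | i j. Suc i < n \<and> Suc j < n}"

definition indices :: "nat \<Rightarrow> grid_index set" where
  "indices n = faces n \<union> edges n \<union> vertices n"

definition cell :: "real \<times> real \<Rightarrow> real \<Rightarrow> nat \<Rightarrow> nat \<Rightarrow> (real \<times> real) set" where
  "cell c d i j =
     {fst c + real i * d .. fst c + real (Suc i) * d} \<times>
     {snd c + real j * d .. snd c + real (Suc j) * d}"

fun region :: "real \<times> real \<Rightarrow> real \<Rightarrow> grid_index \<Rightarrow> (real \<times> real) set" where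
  "region c d (Face i j) = cell c d i j"
| "region c d (VEdge i j) = cell c d i j \<inter> cell c d (Suc i) j"
| "region c d (HEdge i j) = cell c d i j \<inter> cell c d i (Suc j)"
| "region c d (Vertex i j) = {(fst c + real (Suc i) * d, snd c + real (Suc j) * d)}"

fun edge_faces :: "grid_index \<Rightarrow> grid_index set" where
  "edge_faces (VEdge i j) = {Face i j, Face (Suc i) j}"
| "edge_faces (HEdge i j) = {Face i j, Face i (Suc j)}"
| "edge_faces _ = {}"

fun vertex_edges :: "grid_index \<Rightarrow> grid_index set" where
  "vertex_edges (Vertex i j) = {VEdge i j, VEdge i (Suc j), HEdge i j, HEdge (Suc i) j}"
| "vertex_edges _ = {}"

fun vertex_faces :: "grid_index \<Rightarrow> grid_index set" where
  "vertex_faces (Vertex i j) =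
     {Face i j, Face (Suc i) j, Face i (Suc j), Face (Suc i) (Suc j)}"
| "vertex_faces _ = {}"

text \<open>Sanity checks: the numbers of faces, edges and vertices, and agreement of the
  combinatorial incidence sets with geometric incidence.\<close>

lemma card_pairs:
  assumes "\<And>i j i' j'. (C i j :: grid_index) = C i' j' \<longleftrightarrow> i = i' \<and> j = j'"
  shows "finite {C i j | i j. i < a \<and> j < b}" "card {C i j | i j. i < a \<and> j < b} = a * b"
proof -
  have *: "{C i j | i j. i < a \<and> j < b} = (\<lambda>(i, j). C i j) ` ({..<a} \<times> {..<b})"
    by auto
  have "inj_on (\<lambda>(i, j). C i j) ({..<a} \<times> {..<b})"
    by (auto simp: inj_on_def assms)
  then show "card {C i j | i j. i < a \<and> j < b} = a * b"
    unfolding * by (simp add: card_image)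
  show "finite {C i j | i j. i < a \<and> j < b}"
    unfolding * by simp
qed

lemma faces_finite_card: "finite (faces n)" "card (faces n) = n ^ 2"
  using card_pairs[of Face n n] by (simp_all add: faces_def power2_eq_square)

lemma vertices_finite_card: "finite (vertices n)" "card (vertices n) = (n - 1) ^ 2"
  using card_pairs[of Vertex "n - 1" "n - 1"]
  by (simp_all add: vertices_def power2_eq_square less_diff_conv)

lemma edges_finite_card: "finite (edges n)" "card (edges n) = 2 * n * (n - 1)"
proof -
  have V: "finite {VEdge i j | i j. Suc i < n \<and> j < n}"
      "card {VEdge i j | i j. Suc i < n \<and> j < n} = (n - 1) * n"
    using card_pairs[of VEdge "n - 1" n] by (simp_all add: less_diff_conv)
  have H: "finite {HEdge i j | i j. i < n \<and> Suc j < n}"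
      "card {HEdge i j | i j. i < n \<and> Suc j < n} = n * (n - 1)"
    using card_pairs[of HEdge n "n - 1"] by (simp_all add: less_diff_conv)
  show "finite (edges n)" using V H by (simp add: edges_def)
  have "card (edges n) = (n - 1) * n + n * (n - 1)"
    unfolding edges_def using V H by (subst card_Un_disjoint) auto
  then show "card (edges n) = 2 * n * (n - 1)" by simp
qed

lemma region_VEdge:
  "0 < d \<Longrightarrow> region c d (VEdge i j) =
     {fst c + real (Suc i) * d} \<times> {snd c + real j * d .. snd c + real (Suc j) * d}"
  by (auto simp: cell_def algebra_simps)

lemma region_HEdge:
  "0 < d \<Longrightarrow> region c d (HEdge i j) =
     {fst c + real i * d .. fst c + real (Suc i) * d} \<times> {snd c + real (Suc j) * d}"
  by (auto simp: cell_def algebra_simps)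

lemma grid_le: "0 < d \<Longrightarrow> x + real i * d \<le> x + real j * d \<longleftrightarrow> i \<le> (j :: nat)"
  by simp

lemma edge_faces_iff:
  assumes "0 < d" "e \<in> edges n" "f \<in> faces n"
  shows "f \<in> edge_faces e \<longleftrightarrow> region c d e \<subseteq> region c d f"
proof -
  obtain k l where f: "f = Face k l" using assms by (auto simp: faces_def)
  consider i j where "e = VEdge i j" | i j where "e = HEdge i j"
    using assms by (auto simp: edges_def)
  then show ?thesis
  proof cases
    case 1
    show ?thesis using \<open>0 < d\<close>
      unfolding 1 f region_VEdge[OF \<open>0 < d\<close>]
      by (auto simp: cell_def times_subset_iff grid_le simp del: of_nat_Suc)
  next
    case 2
    show ?thesis using \<open>0 < d\<close>
      unfolding 2 f region_HEdge[OF \<open>0 < d\<close>]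
      by (auto simp: cell_def times_subset_iff grid_le simp del: of_nat_Suc)
  qed
qed

lemma vertex_edges_iff:
  assumes "0 < d" "v \<in> vertices n" "e \<in> edges n"
  shows "e \<in> vertex_edges v \<longleftrightarrow> region c d v \<subseteq> region c d e"
proof -
  obtain k l where v: "v = Vertex k l" using assms by (auto simp: vertices_def)
  consider i j where "e = VEdge i j" | i j where "e = HEdge i j"
    using assms by (auto simp: edges_def)
  then show ?thesis
  proof cases
    case 1
    show ?thesis using \<open>0 < d\<close>
      unfolding 1 v region_VEdge[OF \<open>0 < d\<close>]
      by (auto simp: grid_le simp del: of_nat_Suc)
  next
    case 2
    show ?thesis using \<open>0 < d\<close>
      unfolding 2 v region_HEdge[OF \<open>0 < d\<close>]
      by (auto simp: grid_le simp del: of_nat_Suc)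
  qed
qed

lemma vertex_faces_iff:
  assumes "0 < d" "v \<in> vertices n" "f \<in> faces n"
  shows "f \<in> vertex_faces v \<longleftrightarrow> region c d v \<subseteq> region c d f"
proof -
  obtain k l where v: "v = Vertex k l" using assms by (auto simp: vertices_def)
  obtain i j where f: "f = Face i j" using assms by (auto simp: faces_def)
  show ?thesis using \<open>0 < d\<close>
    unfolding v f by (auto simp: cell_def grid_le simp del: of_nat_Suc)
qed

section \<open>Euler histogram, Laplace perturbation and constrained inference\<close>

text \<open>Convex bodies in the sense of Schneider; an empty interior is allowed.\<close>

definition convex_body :: "(real \<times> real) set \<Rightarrow> bool" where
  "convex_body x \<longleftrightarrow> convex x \<and> compact x \<and> x \<noteq> {}"

definition euler_histogram ::
  "real \<times> real \<Rightarrow> real \<Rightarrow> (real \<times> real) set multiset \<Rightarrow> grid_index \<Rightarrow> nat" where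
  "euler_histogram c d X i = size {#x \<in># X. x \<inter> region c d i \<noteq> {}#}"

definition laplace_density :: "real \<Rightarrow> real \<Rightarrow> real" where
  "laplace_density l y = exp (- \<bar>y\<bar> / l) / (2 * l)"

definition perturb :: "(grid_index \<Rightarrow> nat) \<Rightarrow> (grid_index \<Rightarrow> real) \<Rightarrow> grid_index \<Rightarrow> real" where
  "perturb H y i = max 0 (real (H i) + y i)"

text \<open>The maximum norm over a finite nonempty index set; \<^term>\<open>indices n\<close> is nonempty for
  \<^prop>\<open>n \<ge> 1\<close>.\<close>

definition linf_norm :: "grid_index set \<Rightarrow> (grid_index \<Rightarrow> real) \<Rightarrow> real" where
  "linf_norm I v = Max ((\<lambda>i. \<bar>v i\<bar>) ` I)"

definition feasible :: "nat \<Rightarrow> (grid_index \<Rightarrow> real) \<Rightarrow> bool" where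
  "feasible n G \<longleftrightarrow>
     (\<forall>i\<in>indices n. 0 \<le> G i) \<and>
     (\<forall>e\<in>edges n. \<forall>f\<in>edge_faces e. G e \<le> G f) \<and>
     (\<forall>v\<in>vertices n. \<forall>e\<in>vertex_edges v. G v \<le> G e) \<and>
     (\<forall>v\<in>vertices n. 0 \<le> (\<Sum>f\<in>vertex_faces v. G f) - (\<Sum>e\<in>vertex_edges v. G e) + G v)"

definition is_linf_inference :: "nat \<Rightarrow> (grid_index \<Rightarrow> real) \<Rightarrow> (grid_index \<Rightarrow> real) \<Rightarrow> bool" where
  "is_linf_inference n H' G \<longleftrightarrow>
     is_arg_min (\<lambda>G. linf_norm (indices n) (\<lambda>i. G i - H' i)) (feasible n) G"

text \<open>Ties may be broken either way.\<close>

definition is_nearest_int :: "real \<Rightarrow> int \<Rightarrow> bool" where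
  "is_nearest_int x z \<longleftrightarrow> (\<forall>m::int. \<bar>x - of_int z\<bar> \<le> \<bar>x - of_int m\<bar>)"

end

theory Submission
  imports Defs
begin

text \<open>The histogram is itself feasible: around a vertex, each of the four edges can be matched
  with a different incident face, so (C3) already follows from (C1).
  Hence a minimiser is no further from the perturbed counts than the histogram is,
  and the triangle inequality bounds its error by twice the largest noise magnitude. A union bound
  over the Laplace tails of all \<open>(2 n - 1)\<^sup>2\<close> indices controls that magnitude.\<close>

lemma finite_indices: "finite (indices n)"
  by (simp add: indices_def faces_finite_card edges_finite_card vertices_finite_card)

text \<open>This is (2n - 1)^2, written over the reals in the expanded form that becomes the
  numerator inside the logarithm once n = A / d is substituted.\<close>

lemma card_indices:
  assumes "n \<ge> 1"
  shows "real (card (indices n)) = 4 * real n ^ 2 - 4 * real n + 1"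
proof -
  have "faces n \<inter> edges n = {}" "(faces n \<union> edges n) \<inter> vertices n = {}"
    by (auto simp: faces_def edges_def vertices_def)
  then have "card (indices n) = n ^ 2 + 2 * n * (n - 1) + (n - 1) ^ 2"
    unfolding indices_def
    by (simp add: card_Un_disjoint faces_finite_card edges_finite_card vertices_finite_card)
  \<comment> \<open>Writing \<open>n\<close> as a successor removes the truncated subtraction in
    \<open>n - 1\<close>.\<close>
  moreover obtain m where "n = Suc m"
    using assms by (cases n) auto
  ultimately show ?thesis
    by (simp add: power2_eq_square algebra_simps)
qed

lemma indices_nonempty: "n \<ge> 1 \<Longrightarrow> indices n \<noteq> {}"
  by (force simp: indices_def faces_def)

lemma linf_norm_le_iff:
  assumes "finite I" "I \<noteq> {}"
  shows "linf_norm I v \<le> b \<longleftrightarrow> (\<forall>i\<in>I. \<bar>v i\<bar> \<le> b)"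
  using assms by (simp add: linf_norm_def)

text \<open>A body that meets the smaller region also meets the larger one. This reduces (C1) and
  (C2) for the histogram to inclusions between regions.\<close>

lemma euler_histogram_mono:
  assumes "region c d i \<subseteq> region c d j"
  shows "euler_histogram c d X i \<le> euler_histogram c d X j"
  unfolding euler_histogram_def
  using assms by (intro size_mset_mono filter_mset_mono_strong) auto

lemma feasibleI:
  assumes nonneg: "\<And>i. i \<in> indices n \<Longrightarrow> 0 \<le> G i"
    and edge: "\<And>e f. e \<in> edges n \<Longrightarrow> f \<in> edge_faces e \<Longrightarrow> G e \<le> G f"
    and vertex: "\<And>v e. v \<in> vertices n \<Longrightarrow> e \<in> vertex_edges v \<Longrightarrow> G v \<le> G e"
  shows "feasible n G"
proof -
  have "0 \<le> (\<Sum>f\<in>vertex_faces v. G f) - (\<Sum>e\<in>vertex_edges v. G e) + G v"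
    if v: "v \<in> vertices n" for v
  proof -
    obtain i j where ij: "v = Vertex i j" "Suc i < n" "Suc j < n"
      using v by (auto simp: vertices_def)
    \<comment> \<open>Going round the vertex, each edge is paired with the face next to it in
      clockwise direction: lower edge with lower left face, right with lower right, upper with upper
      right, left with upper left. Adding the four inequalities bounds the edge sum by the face
      sum.\<close>
    have "G (VEdge i j) \<le> G (Face i j)"
      "G (HEdge (Suc i) j) \<le> G (Face (Suc i) j)"
      "G (VEdge i (Suc j)) \<le> G (Face (Suc i) (Suc j))"
      "G (HEdge i j) \<le> G (Face i (Suc j))"
      using ij by (auto intro!: edge simp: edges_def)
    moreover have "0 \<le> G v"
      using nonneg v by (simp add: indices_def)
    ultimately show ?thesis
      using ij by simp
  qed
  then show ?thesis
    using assms by (auto simp: feasible_def)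
qed

lemma feasible_euler_histogram:
  assumes "d > 0"
  shows "feasible n (\<lambda>i. real (euler_histogram c d X i))"
proof (rule feasibleI)
  show "real (euler_histogram c d X e) \<le> real (euler_histogram c d X f)"
    if "e \<in> edges n" "f \<in> edge_faces e" for e f
    using that by (auto simp: edges_def intro!: euler_histogram_mono)
  \<comment> \<open>An edge is by definition an intersection of its two faces, but a vertex is given
    by coordinates; that it lies in both cells of an incident edge is arithmetic with
    \<open>d > 0\<close>.\<close>
  show "real (euler_histogram c d X v) \<le> real (euler_histogram c d X e)"
    if "v \<in> vertices n" "e \<in> vertex_edges v" for v e
    using that assms
    by (auto simp: vertices_def cell_def algebra_simps intro!: euler_histogram_mono)
qed simp

text \<open>Clipping at 0 is the projection onto the non-negative reals. It fixes the count
  \<open>H i\<close> and does not increase distances.\<close>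

lemma abs_perturb_diff_le: "\<bar>perturb H y i - real (H i)\<bar> \<le> \<bar>y i\<bar>"
  by (auto simp: perturb_def max_def)

text \<open>The integer \<open>round x\<close> is a competitor within 1/2 of \<open>x\<close>, so
  the bound holds however ties are broken.\<close>

lemma is_nearest_int_dist: "is_nearest_int x z \<Longrightarrow> \<bar>x - of_int z\<bar> \<le> 1 / 2"
  unfolding is_nearest_int_def
  using of_int_round_abs_le[of x] by (metis abs_minus_commute order_trans)

lemma linf_inference_error:
  assumes "n \<ge> 1" and G: "is_linf_inference n H' G" and "feasible n F"
    and close: "\<And>i. i \<in> indices n \<Longrightarrow> \<bar>H' i - F i\<bar> \<le> t" and "i \<in> indices n"
  shows "\<bar>F i - G i\<bar> \<le> 2 * t"
proof -
  note le = linf_norm_le_iff[OF finite_indices indices_nonempty[OF \<open>n \<ge> 1\<close>]]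
  have "linf_norm (indices n) (\<lambda>i. G i - H' i) \<le> linf_norm (indices n) (\<lambda>i. F i - H' i)"
    using G \<open>feasible n F\<close> by (auto simp: is_linf_inference_def is_arg_min_def not_less)
  also have "\<dots> \<le> t"
    using close by (simp add: le abs_minus_commute)
  finally have "\<bar>G i - H' i\<bar> \<le> t"
    using \<open>i \<in> indices n\<close> by (simp add: le)
  with close[OF \<open>i \<in> indices n\<close>] show ?thesis by linarith
qed

text \<open>On \<open>{t..}\<close> the absolute value disappears, and the density has the
  antiderivative \<open>- exp (- y / l) / 2\<close>, which tends to 0 at infinity.\<close>

lemma nn_integral_laplace_upper:
  assumes "l > 0" "t \<ge> 0"
  shows "(\<integral>\<^sup>+ y. ennreal (laplace_density l y) * indicator {t..} y \<partial>lborel) = ennreal (exp (- t / l) / 2)"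
proof -
  have "(\<integral>\<^sup>+ y. ennreal (laplace_density l y) * indicator {t..} y \<partial>lborel)
      = (\<integral>\<^sup>+ y. ennreal (exp (- y / l) / (2 * l)) * indicator {t..} y \<partial>lborel)"
    using assms by (intro nn_integral_cong) (auto simp: laplace_density_def indicator_def)
  also have "\<dots> = ennreal (0 - (- exp (- t / l) / 2))"
  proof (rule nn_integral_FTC_atLeast)
    show "((\<lambda>y. - exp (- y / l) / 2) has_real_derivative exp (- y / l) / (2 * l)) (at y)" for y
      using assms by (auto intro!: derivative_eq_intros)
    have "filterlim (\<lambda>y. y / l) at_top at_top"
      using filterlim_tendsto_pos_mult_at_top[OF tendsto_const[of "1 / l"] _ filterlim_ident] assms
      by simp
    then have "((\<lambda>y. exp (- (y / l))) \<longlongrightarrow> 0) at_top"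
      by (intro filterlim_compose[OF exp_at_bot] filterlim_compose[OF filterlim_uminus_at_bot_at_top])
    then have "((\<lambda>y. - exp (- (y / l)) / 2) \<longlongrightarrow> - 0 / 2) at_top"
      by (intro tendsto_intros) auto
    then show "((\<lambda>y. - exp (- y / l) / 2) \<longlongrightarrow> 0) at_top"
      by simp
  qed (use assms in auto)
  finally show ?thesis by simp
qed

text \<open>The two-sided tail splits into two half-lines, disjoint because \<open>t > 0\<close>,
  and by symmetry of the density each contributes half of the result.\<close>

lemma nn_integral_laplace_tail:
  assumes "l > 0" "t > 0"
  shows "(\<integral>\<^sup>+ y. ennreal (laplace_density l y) * indicator {y. t \<le> \<bar>y\<bar>} y \<partial>lborel) = ennreal (exp (- t / l))"
proof -
  have [measurable]: "laplace_density l \<in> borel_measurable borel"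
    unfolding laplace_density_def by measurable
  let ?f = "\<lambda>y. ennreal (laplace_density l y)"
  have "(\<integral>\<^sup>+ y. ?f y * indicator {y. t \<le> \<bar>y\<bar>} y \<partial>lborel)
      = (\<integral>\<^sup>+ y. ?f y * indicator {t..} y + ?f y * indicator {..- t} y \<partial>lborel)"
    using assms by (intro nn_integral_cong) (auto simp: indicator_def)
  also have "\<dots> = (\<integral>\<^sup>+ y. ?f y * indicator {t..} y \<partial>lborel) + (\<integral>\<^sup>+ y. ?f y * indicator {..- t} y \<partial>lborel)"
    by (intro nn_integral_add) auto
  \<comment> \<open>The substitution of \<open>- y\<close> for \<open>y\<close> carries the lower
    tail to the upper one.\<close>
  also have "(\<integral>\<^sup>+ y. ?f y * indicator {..- t} y \<partial>lborel)
      = (\<integral>\<^sup>+ y. ?f (- y) * indicator {..- t} (- y) \<partial>lborel)"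
    by (subst nn_integral_real_affine[where c = "-1" and t = 0]) auto
  also have "\<dots> = (\<integral>\<^sup>+ y. ?f y * indicator {t..} y \<partial>lborel)"
    by (intro nn_integral_cong) (auto simp: laplace_density_def indicator_def)
  finally show ?thesis
    using assms by (simp add: nn_integral_laplace_upper flip: ennreal_plus)
qed

lemma (in prob_space) laplace_tail:
  assumes Y: "distributed M lborel Y (\<lambda>y. ennreal (laplace_density l y))" and "l > 0" "t > 0"
  shows "prob {\<omega> \<in> space M. t \<le> \<bar>Y \<omega>\<bar>} = exp (- t / l)"
proof -
  have eq: "{\<omega> \<in> space M. t \<le> \<bar>Y \<omega>\<bar>} = Y -` {y. t \<le> \<bar>y\<bar>} \<inter> space M" by auto
  have "emeasure M {\<omega> \<in> space M. t \<le> \<bar>Y \<omega>\<bar>} = ennreal (exp (- t / l))"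
    unfolding eq using assms
    by (subst distributed_emeasure[OF Y]) (auto simp: nn_integral_laplace_tail)
  then show ?thesis by (simp add: measure_def)
qed

theorem corollary4:
  fixes \<epsilon> B d A lam \<delta> :: real and n :: nat and c :: "real \<times> real"
    and X :: "(real \<times> real) set multiset"
    and H :: "grid_index \<Rightarrow> nat"
    and M :: "'w measure"
    and Y H' H'' :: "grid_index \<Rightarrow> 'w \<Rightarrow> real"
    and H''' :: "grid_index \<Rightarrow> 'w \<Rightarrow> int"
  assumes "\<epsilon> > 0" and "B > 0" and "d > 0" and "n \<ge> 1" and "A = real n * d"
    and "\<And>x. x \<in># X \<Longrightarrow> convex_body x \<and> diameter x \<le> B"
    and "H = euler_histogram c d X"
    and "lam = 1 / \<epsilon> * (4.5 * (real_of_int \<lceil>B / d\<rceil> + 1) * real_of_int \<lceil>B / d\<rceil>)"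
    and "prob_space M"
    and "prob_space.indep_vars M (\<lambda>_. borel) Y (indices n)"
    and "\<And>i. i \<in> indices n \<Longrightarrow> distributed M lborel (Y i) (\<lambda>y. ennreal (laplace_density lam y))"
    and "\<And>i \<omega>. H' i \<omega> = perturb H (\<lambda>j. Y j \<omega>) i"
    and "\<And>\<omega>. \<omega> \<in> space M \<Longrightarrow> is_linf_inference n (\<lambda>i. H' i \<omega>) (\<lambda>i. H'' i \<omega>)"
    and "\<And>i \<omega>. i \<in> indices n \<Longrightarrow> \<omega> \<in> space M \<Longrightarrow> is_nearest_int (H'' i \<omega>) (H''' i \<omega>)"
    and "0 < \<delta>" and "\<delta> < 1"
  shows "\<exists>E\<in>sets M. measure M E \<ge> 1 - \<delta> \<and>
    (\<forall>\<omega>\<in>E. linf_norm (indices n) (\<lambda>i. real (H i) - real_of_int (H''' i \<omega>))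
       \<le> 9 * (real_of_int \<lceil>B / d\<rceil> + 1) * real_of_int \<lceil>B / d\<rceil> / \<epsilon>
           * ln ((4 * A^2 / d^2 - 4 * A / d + 1) / \<delta>) + 0.5)"
proof -
  interpret prob_space M by fact
  let ?I = "indices n"
  let ?k = "real_of_int \<lceil>B / d\<rceil>"
  define N where "N = real (card ?I)"
  \<comment> \<open>With this threshold each of the \<open>N\<close> tails has probability exp(-t /
    lam) = \<delta> / N, so the union bound gives exactly \<delta>.\<close>
  define t where "t = lam * ln (N / \<delta>)"
  have "0 < B / d" using assms by simp
  then have "?k > 0" by simp
  then have "?k + 1 > 0" by linarith
  with \<open>?k > 0\<close> \<open>\<epsilon> > 0\<close> have lam: "lam > 0" unfolding \<open>lam = _\<close> by (intro mult_pos_pos) auto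
  have "card ?I > 0"
    using indices_nonempty[OF \<open>n \<ge> 1\<close>] finite_indices by (simp add: card_gt_0_iff)
  then have "N \<ge> 1" by (simp add: N_def)
  \<comment> \<open>The logarithm must be positive, since the tail formula is applied with a
    strictly positive threshold.\<close>
  with \<open>0 < \<delta>\<close> \<open>\<delta> < 1\<close> have ratio: "N / \<delta> > 1" by (simp add: field_simps)
  with lam have t: "t > 0" by (simp add: t_def)
  have N: "N = 4 * A^2 / d^2 - 4 * A / d + 1"
    using assms by (simp add: N_def card_indices power_mult_distrib)
  define bad where "bad i = {\<omega> \<in> space M. t \<le> \<bar>Y i \<omega>\<bar>}" for i
  have [measurable]: "Y i \<in> borel_measurable M" if "i \<in> ?I" for i
    using assms(11)[OF that] by (simp add: distributed_def)
  have bad: "bad i \<in> events" if "i \<in> ?I" for i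
    using that unfolding bad_def by measurable
  have "prob (\<Union>i\<in>?I. bad i) \<le> (\<Sum>i\<in>?I. prob (bad i))"
    using bad by (intro finite_measure_subadditive_finite finite_indices) auto
  also have "\<dots> = (\<Sum>i\<in>?I. exp (- t / lam))"
    unfolding bad_def using assms(11) lam t by (intro sum.cong refl laplace_tail) auto
  also have "\<dots> = N * (\<delta> / N)"
    using lam ratio \<open>0 < \<delta>\<close> \<open>N \<ge> 1\<close> by (simp add: t_def N_def exp_minus)
  also have "\<dots> = \<delta>" using \<open>N \<ge> 1\<close> by simp
  finally have union: "prob (\<Union>i\<in>?I. bad i) \<le> \<delta>" .
  have meas: "(\<Union>i\<in>?I. bad i) \<in> events"
    using bad finite_indices by (intro sets.finite_UN) auto
  show ?thesis
  proof (intro bexI conjI ballI)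
    \<comment> \<open>The witness is defined through the noise alone. The set of all outcomes with
      small error also depends on the chosen minimisers and roundings, and these choices may vary
      non-measurably with the outcome.\<close>
    show "space M - (\<Union>i\<in>?I. bad i) \<in> events" using meas by auto
    show "1 - \<delta> \<le> prob (space M - (\<Union>i\<in>?I. bad i))"
      using union by (simp add: prob_compl[OF meas])
    fix \<omega> assume \<omega>: "\<omega> \<in> space M - (\<Union>i\<in>?I. bad i)"
    have "\<bar>real (H i) - real_of_int (H''' i \<omega>)\<bar> \<le> 2 * t + 1 / 2" if i: "i \<in> ?I" for i
    proof -
      have "\<bar>real (H i) - H'' i \<omega>\<bar> \<le> 2 * t"
      proof (rule linf_inference_error[OF \<open>n \<ge> 1\<close> _ _ _ i])
        show "is_linf_inference n (\<lambda>i. H' i \<omega>) (\<lambda>i. H'' i \<omega>)"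
          using \<omega> assms(13) by simp
        show "feasible n (\<lambda>i. real (H i))"
          using assms by (simp add: feasible_euler_histogram)
        show "\<bar>H' j \<omega> - real (H j)\<bar> \<le> t" if "j \<in> ?I" for j
        proof -
          have "\<bar>Y j \<omega>\<bar> < t" using \<omega> that by (auto simp: bad_def not_le)
          then show ?thesis
            using abs_perturb_diff_le[of H "\<lambda>j. Y j \<omega>" j] by (simp add: assms(12))
        qed
      qed
      moreover have "\<bar>H'' i \<omega> - real_of_int (H''' i \<omega>)\<bar> \<le> 1 / 2"
        using assms(14) i \<omega> by (intro is_nearest_int_dist) auto
      ultimately show ?thesis by linarith
    qed
    then have "linf_norm ?I (\<lambda>i. real (H i) - real_of_int (H''' i \<omega>)) \<le> 2 * t + 1 / 2"
      using linf_norm_le_iff[OF finite_indices indices_nonempty[OF \<open>n \<ge> 1\<close>]] by blast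
    \<comment> \<open>The constant 9 is twice the 4.5 in the noise scale; the remaining 1/2 is the
      rounding error.\<close>
    also have "2 * t = 9 * (?k + 1) * ?k / \<epsilon> * ln (N / \<delta>)"
      by (simp add: t_def \<open>lam = _\<close>)
    finally show "linf_norm ?I (\<lambda>i. real (H i) - real_of_int (H''' i \<omega>))
       \<le> 9 * (?k + 1) * ?k / \<epsilon> * ln ((4 * A^2 / d^2 - 4 * A / d + 1) / \<delta>) + 0.5"
      by (simp add: N)
  qed
qed

end
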